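(* Let $G\in\mathcal{G}$ with $d_G>0$. Suppose that there exist a sequence $(\tau_k)_k$ with $\tau_k\in[2,\infty)$ and $\lim_{k\to\infty}\tau_k=\infty$ and an $\alpha\in(0,\infty)$ such that $$\lim_{k\to\infty}\left|G(\tfrac12+i\tau_k)\right|=\alpha.$$ Then, for any positive function $\mu:[2,\infty)\to\mathbb{R}^+$ with $\lim_{\tau\to\infty}\mu(\tau)=\infty$, the discs defined by $$\left|s-\tfrac12-i\tau_k\right|<\frac{\mu(\tau_k)}{\log\tau_k},\qquad k\in\mathbb{N},$$ form a sequence of filling discs for $G$. In particular, $\sigma=\frac12$ is a Julia line of $G$; and $G$ assumes every value $a\in\widehat{\mathbb{C}}$, with at most two exceptions, infinitely often inside the region defined by $$\frac12-\frac{\mu(t)}{\log t}<\sigma<\frac12+\frac{\mu(t)}{\log t},\qquad t\ge2.$$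
   Context: Write $s=\sigma+it$ and $\widehat{\mathbb{C}}=\mathbb{C}\cup\{\infty\}$. For a parameter tuple $p=(\omega,Q,\lambda_1,\dots,\lambda_f,\mu_1,\dots,\mu_f)$, $f\in\mathbb{N}_0$, with positive real numbers $Q,\lambda_1,\dots,\lambda_f$ and complex numbers $\omega,\mu_1,\dots,\mu_f$, $|\omega|=1$, put $$\Delta_p(s):=\omega Q^{1-2s}\prod_{j=1}^f\frac{\Gamma(\lambda_j(1-s)+\overline{\mu_j})}{\Gamma(\lambda_js+\mu_j)},\qquad d_p:=2\sum_{j=1}^f\lambda_j$$ (so $d_p=0$ if $f=0$). Let $\mathcal{D}=\{\sigma+it:0<\sigma<1,\ t>0\}$. A function $G\not\equiv0$ belongs to the class $\mathcal{G}$ if it is meromorphic in the half-strip $\mathcal{D}$ and there is such a tuple $p$ with $G(s)=\Delta_p(s)\overline{G(1-\overline s)}$ for $s\in\mathcal{D}$; the number $d_G:=d_p$ depends only on $G$ and is called the degree of $G$. For a domain $\Omega\subset\mathbb{C}$, a function $g$ meromorphic on $\Omega$ and $E\subset\Omega$, one says that $g$ satisfies the Picard-property on $E$ if $g$ assumes on $E$ every value $a\in\widehat{\mathbb{C}}$, with at most two exceptions. With $D_r(z)$ denoting the open disc of radius $r$ and center $z$, a sequence of discs $D_{\lambda_n}(z_n)\subset\Omega$, $n\in\mathbb{N}$, is called a sequence of filling discs for $g$ if, for arbitrary $0<\varepsilon\le1$, $g$ satisfies the Picard-property on every infinite union $\bigcup_{k\in\mathbb{N}}D_{\varepsilon\lambda_{n_k}}(z_{n_k})$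 of the discs $D_{\varepsilon\lambda_n}(z_n)$. A line $L=\{z_0+re^{i\theta_0}:r\in\mathbb{R}\}$, with fixed $z_0\in\mathbb{C}$ and $\theta_0\in[0,2\pi)$, is called a Julia line for a function $g$ (the definition is formulated for $g$ meromorphic in $\mathbb{C}$) if $g$ satisfies the Picard-property in every open strip containing $L$. *)

theory Defs
  imports "HOL-Complex_Analysis.Complex_Analysis"
begin

section \<open>The class of solutions of the functional equation\<close>

definition half_strip :: "complex set" where
  "half_strip = {s. 0 < Re s \<and> Re s < 1 \<and> Im s > 0}"

text \<open>
  Parameter tuples. Only the values of \<open>par_lambda\<close> and \<open>par_mu\<close> at the
  indices \<open>1, \<dots>, par_f\<close> are relevant.
\<close>

record fe_param =
  par_omega :: complex
  par_Q :: real
  par_f :: nat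
  par_lambda :: "nat \<Rightarrow> real"
  par_mu :: "nat \<Rightarrow> complex"

definition admissible :: "fe_param \<Rightarrow> bool" where
  "admissible p \<longleftrightarrow> norm (par_omega p) = 1 \<and> par_Q p > 0 \<and> (\<forall>j\<in>{1..par_f p}. par_lambda p j > 0)"

definition fe_Delta :: "fe_param \<Rightarrow> complex \<Rightarrow> complex" where
  "fe_Delta p s =
     par_omega p * of_real (par_Q p) powr (1 - 2 * s) *
     (\<Prod>j\<in>{1..par_f p}. Gamma (of_real (par_lambda p j) * (1 - s) + cnj (par_mu p j)) /
                         Gamma (of_real (par_lambda p j) * s + par_mu p j))"

definition param_degree :: "fe_param \<Rightarrow> real" where
  "param_degree p = 2 * (\<Sum>j\<in>{1..par_f p}. par_lambda p j)"

text \<open>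
  The functional equation is an identity between meromorphic functions. Since a pole
  has no genuine value in type \<^typ>\<open>complex\<close> (both \<^const>\<open>Gamma\<close> and the normalised
  \<open>G\<close> below take the value \<open>0\<close> there), the equation is required off a set without limit
  points in the half-strip.
\<close>

definition functional_equation :: "fe_param \<Rightarrow> (complex \<Rightarrow> complex) \<Rightarrow> bool" where
  "functional_equation p G \<longleftrightarrow> (\<forall>\<^sub>\<approx>s\<in>half_strip. G s = fe_Delta p s * cnj (G (1 - cnj s)))"

text \<open>
  Meromorphic functions are represented by their normal form \<^const>\<open>nicely_meromorphic_on\<close>:
  removable singularities are removed and the value at a pole is the dummy value \<open>0\<close>.
\<close>

definition class_G :: "(complex \<Rightarrow> complex) set" where
  "class_G = {G. G nicely_meromorphic_on half_strip \<and> (\<exists>s\<in>half_strip. G s \<noteq> 0) \<and>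
                 (\<exists>p. admissible p \<and> functional_equation p G)}"

text \<open>
  The degree does not depend on the choice of the parameter tuple in the functional equation.
\<close>

definition degree_G :: "(complex \<Rightarrow> complex) \<Rightarrow> real" where
  "degree_G G = param_degree (SOME p. admissible p \<and> functional_equation p G)"


section \<open>Value distribution\<close>

text \<open>
  The extended plane is \<^typ>\<open>complex option\<close>, with \<^const>\<open>None\<close> as the point at infinity
  (as in the library's \<^const>\<open>Alexandroff_compactification\<close>).
  For \<open>g\<close> in normal form, the following is the value of \<open>g\<close> in the extended plane.
\<close>

definition ext_value :: "(complex \<Rightarrow> complex) \<Rightarrow> complex \<Rightarrow> complex option" where
  "ext_value g z = (if is_pole g z then None else Some (g z))"

definition picard_property_on :: "(complex \<Rightarrow> complex) \<Rightarrow> complex set \<Rightarrow> bool" where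
  "picard_property_on g E \<longleftrightarrow>
     (\<exists>X. finite X \<and> card X \<le> 2 \<and> (\<forall>a. a \<notin> X \<longrightarrow> (\<exists>z\<in>E. ext_value g z = a)))"

text \<open>
  A sequence of discs with centres \<open>z n\<close> and radii \<open>r n\<close>, for a function \<open>g\<close> meromorphic on
  \<open>\<Omega>\<close>. Discs are allowed to stick out of \<open>\<Omega>\<close>, in which case only their parts inside \<open>\<Omega>\<close>,
  where \<open>g\<close> is defined, count; for discs contained in \<open>\<Omega>\<close> the intersection with \<open>\<Omega>\<close> has
  no effect (see the lemma below).
\<close>

definition filling_discs ::
  "complex set \<Rightarrow> (complex \<Rightarrow> complex) \<Rightarrow> (nat \<Rightarrow> complex) \<Rightarrow> (nat \<Rightarrow> real) \<Rightarrow> bool" where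
  "filling_discs \<Omega> g z r \<longleftrightarrow>
     (\<forall>\<epsilon> \<phi>. 0 < \<epsilon> \<and> \<epsilon> \<le> 1 \<and> strict_mono \<phi> \<longrightarrow>
        picard_property_on g (\<Omega> \<inter> (\<Union>k::nat. ball (z (\<phi> k)) (\<epsilon> * r (\<phi> k)))))"

lemma filling_discs_iff_contained:
  assumes "\<And>n. ball (z n) (r n) \<subseteq> \<Omega>"
  shows "filling_discs \<Omega> g z r \<longleftrightarrow>
     (\<forall>\<epsilon> \<phi>. 0 < \<epsilon> \<and> \<epsilon> \<le> 1 \<and> strict_mono \<phi> \<longrightarrow>
        picard_property_on g (\<Union>k::nat. ball (z (\<phi> k)) (\<epsilon> * r (\<phi> k))))"
proof -
  have *: "ball (z n) (\<epsilon> * r n) \<subseteq> \<Omega>" if "0 < \<epsilon>" "\<epsilon> \<le> 1" for n \<epsilon>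
  proof (cases "r n \<ge> 0")
    case True
    then have "\<epsilon> * r n \<le> r n"
      using that by (simp add: mult_left_le_one_le)
    then show ?thesis using assms[of n] by (meson order_trans subset_ball)
  next
    case False
    then have "\<epsilon> * r n \<le> 0"
      using that by (simp add: mult_nonneg_nonpos)
    then show ?thesis by (simp add: ball_empty)
  qed
  have "\<Omega> \<inter> (\<Union>k::nat. ball (z (\<phi> k)) (\<epsilon> * r (\<phi> k))) = (\<Union>k::nat. ball (z (\<phi> k)) (\<epsilon> * r (\<phi> k)))"
    if "0 < \<epsilon>" "\<epsilon> \<le> 1" for \<epsilon> :: real and \<phi> :: "nat \<Rightarrow> nat"
    using *[OF that] by blast
  then show ?thesis unfolding filling_discs_def by auto
qed

definition complex_line :: "complex set \<Rightarrow> bool" where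
  "complex_line L \<longleftrightarrow>
     (\<exists>z0 \<theta>. 0 \<le> \<theta> \<and> \<theta> < 2 * pi \<and> L = {z0 + of_real r * cis \<theta> | r :: real. True})"

text \<open>
  The open region between two distinct parallel lines of direction \<^term>\<open>cis \<theta>\<close>.
\<close>

definition open_strip :: "complex set \<Rightarrow> bool" where
  "open_strip S \<longleftrightarrow>
     (\<exists>\<theta> a b. a < b \<and> S = {z. a < Im (cis (- \<theta>) * z) \<and> Im (cis (- \<theta>) * z) < b})"

text \<open>
  Julia lines of a function \<open>g\<close> meromorphic on \<open>\<Omega>\<close>; the usual notion is the case
  \<open>\<Omega> = UNIV\<close>.
\<close>

definition julia_line :: "complex set \<Rightarrow> (complex \<Rightarrow> complex) \<Rightarrow> complex set \<Rightarrow> bool" where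
  "julia_line \<Omega> g L \<longleftrightarrow>
     complex_line L \<and> (\<forall>S. open_strip S \<and> L \<subseteq> S \<longrightarrow> picard_property_on g (\<Omega> \<inter> S))"

definition infinitely_often_picard_on :: "(complex \<Rightarrow> complex) \<Rightarrow> complex set \<Rightarrow> bool" where
  "infinitely_often_picard_on g E \<longleftrightarrow>
     (\<exists>X. finite X \<and> card X \<le> 2 \<and> (\<forall>a. a \<notin> X \<longrightarrow> infinite {z\<in>E. ext_value g z = a}))"

end

theory Submission
  imports Defs "HOL-Real_Asymp.Real_Asymp"
begin

text \<open>
  Write \<open>s\<^sub>k = 1/2 + i \<tau>\<^sub>k\<close> and \<open>d\<close> for the degree. The natural unit of length near \<open>s\<^sub>k\<close> is
  \<open>1 / ln \<tau>\<^sub>k\<close>: by the growth of the Gamma function, the modulus of \<open>\<Delta>\<^sub>p\<close> that far to the right of the critical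
  line is at most \<open>exp (- d)\<close> in the limit (\<open>fe_Delta_bound\<close>).

  Suppose that \<open>G\<close> omits three values of the extended plane on a set that contains, for each \<open>R\<close>,
  infinitely many of the discs of radius \<open>R / ln \<tau>\<^sub>k\<close> about \<open>s\<^sub>k\<close>. Measured in the unit \<open>1 / ln \<tau>\<^sub>k\<close>
  these discs exhaust the plane, and a meromorphic function that omits three values in the whole plane
  is constant. Schottky's theorem is the quantitative form of this fact and shows that \<open>G\<close> is
  asymptotically constant at bounded distance from \<open>s\<^sub>k\<close>, in this unit
  (\<open>omits_three_values_tendsto\<close>). Along a subsequence, \<open>G\<close> therefore has one and the same limit \<open>w\<^sub>0\<close>
  at \<open>s\<^sub>k\<close> and at \<open>s\<^sub>k \<plusminus> 1 / ln \<tau>\<^sub>k\<close>, and \<open>\<bar>w\<^sub>0\<bar> = \<alpha>\<close>. The map \<open>s \<mapsto> 1 - cnj s\<close> exchanges the last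
  two points, so the functional equation yields \<open>\<alpha> \<le> exp (- d) \<alpha>\<close> in the limit. This is absurd, since
  \<open>d > 0\<close> and \<open>0 < \<alpha> < \<infinity>\<close>.

  This contradiction is \<open>critical_line_sequence_takes_value\<close>. The assertions on filling discs, the
  Julia line and the region around the critical line all follow from it, because each of the sets
  concerned contains the discs of radius \<open>R / ln \<tau>\<^sub>k\<close>, intersected with the half-strip, for
  infinitely many \<open>k\<close>.
\<close>

section \<open>Growth of quotients of Gamma values\<close>

text \<open>
  This controls, uniformly in \<open>b\<close>, the total error when \<open>square_increment_le_log_increment\<close> is summed
  along \<open>u = b, b + 1, b + 2, \<dots>\<close>. The reason is that \<open>k + 1\<close> is the sum of \<open>b + k\<close> and the bounded
  number \<open>1 - b\<close>.
\<close>

lemma sum_inverse_shifted_squares_le: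
  fixes b m :: real
  assumes "\<bar>b\<bar> \<le> m"
  shows "(\<Sum>k\<le>n. 1 / ((b + real k)\<^sup>2 + 1)) \<le> 2 * (1 + m)\<^sup>2 * (pi\<^sup>2 / 6)"
proof -
  have "1 / ((b + real k)\<^sup>2 + 1) \<le> 2 * (1 + m)\<^sup>2 * (1 / (real k + 1)\<^sup>2)" for k
  proof -
    have "(real k + 1)\<^sup>2 = ((b + real k) + (1 - b))\<^sup>2"
      by (simp add: algebra_simps)
    also have "\<dots> \<le> 2 * (b + real k)\<^sup>2 + 2 * (1 - b)\<^sup>2"
    proof -
      have "(x + y)\<^sup>2 \<le> 2 * x\<^sup>2 + 2 * y\<^sup>2" for x y :: real
        using zero_le_power2[of "x - y"] by (simp add: power2_eq_square algebra_simps)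
      then show ?thesis .
    qed
    also have "(1 - b)\<^sup>2 \<le> (1 + m)\<^sup>2"
      using assms by (intro abs_le_square_iff[THEN iffD1]) auto
    also have "2 * (b + real k)\<^sup>2 + 2 * (1 + m)\<^sup>2 \<le> 2 * (1 + m)\<^sup>2 * ((b + real k)\<^sup>2 + 1)"
    proof -
      have "1 \<le> (1 + m)\<^sup>2" using assms by (simp add: one_le_power)
      then have "(b + real k)\<^sup>2 * 1 \<le> (b + real k)\<^sup>2 * (1 + m)\<^sup>2"
        by (intro mult_left_mono) auto
      then show ?thesis by (simp add: algebra_simps)
    qed
    finally show ?thesis
      by (simp add: field_simps add_pos_nonneg)
  qed
  then have "(\<Sum>k\<le>n. 1 / ((b + real k)\<^sup>2 + 1)) \<le> (\<Sum>k\<le>n. 2 * (1 + m)\<^sup>2 * (1 / (real k + 1)\<^sup>2))"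
    by (intro sum_mono)
  also have "\<dots> = 2 * (1 + m)\<^sup>2 * (\<Sum>k\<le>n. 1 / (real k + 1)\<^sup>2)"
    by (simp add: sum_distrib_left)
  also have "(\<Sum>k\<le>n. 1 / (real k + 1)\<^sup>2) \<le> pi\<^sup>2 / 6"
    using sums_unique[OF inverse_squares_sums] sum_le_suminf[OF sums_summable[OF inverse_squares_sums], of "{..n}"]
    by (simp add: add.commute)
  finally show ?thesis by (simp add: mult_left_mono)
qed

text \<open>
  The left-hand side is \<open>y\<close> if the quotient of \<open>(u + 1)\<^sup>2 + T\<^sup>2\<close> and \<open>u\<^sup>2 + T\<^sup>2\<close> is written as \<open>1 + y\<close>,
  and \<open>y\<close> differs from \<open>ln (1 + y)\<close> only to second order. Hence sums of the left-hand side telescope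
  up to a convergent error.
\<close>

lemma square_increment_le_log_increment:
  fixes u T :: real
  assumes "T \<ge> 4"
  shows "(2 * u + 1) / (u\<^sup>2 + T\<^sup>2) \<le> ln ((u + 1)\<^sup>2 + T\<^sup>2) - ln (u\<^sup>2 + T\<^sup>2) + 16 * (1 / (u\<^sup>2 + 1))"
proof -
  define y where "y = (2 * u + 1) / (u\<^sup>2 + T\<^sup>2)"
  have T2: "T\<^sup>2 \<ge> 16" using power_mono[of 4 T 2] assms by simp
  then have pos: "u\<^sup>2 + T\<^sup>2 > 0" by (smt (verit) zero_le_power2)
  have "\<bar>y\<bar> \<le> 1/2"
  proof -
    have "0 \<le> (\<bar>u\<bar> - 2)\<^sup>2" by simp
    then have "4 * \<bar>u\<bar> + 2 \<le> u\<^sup>2 + T\<^sup>2"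
      using T2 by (simp add: power2_eq_square algebra_simps)
    then have "2 * \<bar>2 * u + 1\<bar> \<le> u\<^sup>2 + T\<^sup>2"
      using abs_triangle_ineq[of "2 * u" 1] by (simp add: abs_mult)
    then show ?thesis using pos by (simp add: y_def field_simps)
  qed
  from abs_ln_one_plus_x_minus_x_bound[OF this]
  have "y \<le> ln (1 + y) + 2 * y\<^sup>2" by linarith
  also have "1 + y = ((u\<^sup>2 + T\<^sup>2) + (2 * u + 1)) / (u\<^sup>2 + T\<^sup>2)"
    using pos by (metis add_divide_distrib divide_self less_irrefl y_def)
  also have "(u\<^sup>2 + T\<^sup>2) + (2 * u + 1) = (u + 1)\<^sup>2 + T\<^sup>2"
    by (simp add: power2_eq_square algebra_simps)
  also have "ln (((u + 1)\<^sup>2 + T\<^sup>2) / (u\<^sup>2 + T\<^sup>2)) = ln ((u + 1)\<^sup>2 + T\<^sup>2) - ln (u\<^sup>2 + T\<^sup>2)"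
    using pos T2 by (intro ln_divide_pos add_nonneg_pos) (use assms in auto)
  also have "y\<^sup>2 \<le> 8 * (1 / (u\<^sup>2 + 1))"
  proof -
    have "0 \<le> (2 * u - 1)\<^sup>2" by simp
    then have "(2 * u + 1)\<^sup>2 \<le> 8 * (u\<^sup>2 + T\<^sup>2)"
      using T2 by (simp add: power2_eq_square algebra_simps)
    then have "y\<^sup>2 \<le> 8 * (u\<^sup>2 + T\<^sup>2) / (u\<^sup>2 + T\<^sup>2)\<^sup>2"
      unfolding y_def power_divide by (intro divide_right_mono) auto
    also have "\<dots> = 8 / (u\<^sup>2 + T\<^sup>2)"
      using pos unfolding power2_eq_square[of "u\<^sup>2 + T\<^sup>2"] by (metis less_irrefl mult_divide_mult_cancel_right)
    also have "\<dots> \<le> 8 / (u\<^sup>2 + 1)" using T2 by (intro divide_left_mono) (auto simp: add_nonneg_pos intro!: mult_pos_pos pos)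
    finally show ?thesis by simp
  qed
  finally show ?thesis by (simp add: y_def)
qed

text \<open>
  A shift by \<open>\<delta>\<close> to the right multiplies the squared modulus of each factor \<open>b + k + i T\<close> by
  at most \<open>exp (\<delta> y\<^sub>k)\<close>, with \<open>y\<^sub>k\<close> as in \<open>square_increment_le_log_increment\<close>; the sum of the \<open>y\<^sub>k\<close>
  telescopes.
\<close>

lemma norm_pochhammer_shift_le:
  fixes b T \<delta> m :: real
  assumes b: "\<bar>b\<bar> \<le> m" and T: "T \<ge> 4" and \<delta>: "0 \<le> \<delta>" "\<delta> \<le> 1"
  defines "C \<equiv> 16 * (1 + m)\<^sup>2 * (pi\<^sup>2 / 6)"
  shows "norm (pochhammer (Complex (b + \<delta>) T) (Suc n)) \<le>
         norm (pochhammer (Complex b T) (Suc n)) *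
           exp (\<delta> * (ln ((b + real n + 1)\<^sup>2 + T\<^sup>2) / 2 - ln T + C))"
proof -
  define L where "L k = ln ((b + real k)\<^sup>2 + T\<^sup>2)" for k
  define y where "y k = (2 * (b + real k) + 1) / ((b + real k)\<^sup>2 + T\<^sup>2)" for k
  have pos: "u\<^sup>2 + T\<^sup>2 > 0" for u using T by (simp add: add_nonneg_pos)
  have factor: "(norm (Complex (b + \<delta>) T + of_nat k))\<^sup>2 \<le> (norm (Complex b T + of_nat k))\<^sup>2 * exp (\<delta> * y k)" for k
  proof -
    define u where "u = b + real k"
    have n1: "(norm (Complex (b + \<delta>) T + of_nat k))\<^sup>2 = (u + \<delta>)\<^sup>2 + T\<^sup>2"
      by (simp add: cmod_power2 u_def algebra_simps)
    have n2: "(norm (Complex b T + of_nat k))\<^sup>2 = u\<^sup>2 + T\<^sup>2"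
      by (simp add: cmod_power2 u_def)
    have "\<delta> * \<delta> \<le> \<delta> * 1" using \<delta> by (intro mult_left_mono) auto
    then have "(u + \<delta>)\<^sup>2 + T\<^sup>2 \<le> u\<^sup>2 + T\<^sup>2 + \<delta> * (2 * u + 1)"
      by (simp add: power2_eq_square algebra_simps)
    also have "2 * u + 1 = (u\<^sup>2 + T\<^sup>2) * y k"
      using pos[of u] unfolding y_def u_def[symmetric]
      by (metis less_numeral_extra(3) nonzero_mult_div_cancel_left times_divide_eq_right)
    also have "u\<^sup>2 + T\<^sup>2 + \<delta> * ((u\<^sup>2 + T\<^sup>2) * y k) = (u\<^sup>2 + T\<^sup>2) * (1 + \<delta> * y k)"
      by (simp add: algebra_simps)
    also have "\<dots> \<le> (u\<^sup>2 + T\<^sup>2) * exp (\<delta> * y k)"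
      using pos[of u] exp_ge_add_one_self by (intro mult_left_mono) auto
    finally show ?thesis using n1 n2 by simp
  qed
  have L0: "L 0 \<ge> 2 * ln T"
  proof -
    have "2 * ln T = ln (T\<^sup>2)" using T by (simp add: ln_realpow)
    also have "\<dots> \<le> L 0" unfolding L_def using T by (intro ln_mono) (auto simp: add_nonneg_pos)
    finally show ?thesis .
  qed
  have "(\<Sum>k\<le>n. y k) \<le> (\<Sum>k\<le>n. L (Suc k) - L k + 16 * (1 / ((b + real k)\<^sup>2 + 1)))"
    using square_increment_le_log_increment[OF T, of "b + real k" for k]
    by (intro sum_mono) (simp add: y_def L_def algebra_simps)
  also have "\<dots> = L (Suc n) - L 0 + 16 * (\<Sum>k\<le>n. 1 / ((b + real k)\<^sup>2 + 1))"
    by (simp add: sum.distrib sum_distrib_left lessThan_Suc_atMost[symmetric] sum_lessThan_telescope)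
  also have "16 * (\<Sum>k\<le>n. 1 / ((b + real k)\<^sup>2 + 1)) \<le> 2 * C"
    using sum_inverse_shifted_squares_le[OF b, of n] by (simp add: C_def)
  finally have sum_y: "(\<Sum>k\<le>n. y k) \<le> L (Suc n) - 2 * ln T + 2 * C" using L0 by simp
  have "(norm (pochhammer (Complex (b + \<delta>) T) (Suc n)))\<^sup>2 =
        (\<Prod>k\<le>n. (norm (Complex (b + \<delta>) T + of_nat k))\<^sup>2)"
    by (simp add: pochhammer_Suc_prod atLeast0AtMost prod_norm[symmetric] prod_power_distrib)
  also have "\<dots> \<le> (\<Prod>k\<le>n. (norm (Complex b T + of_nat k))\<^sup>2 * exp (\<delta> * y k))"
    by (intro prod_mono conjI factor) auto
  also have "\<dots> = (norm (pochhammer (Complex b T) (Suc n)))\<^sup>2 * exp (\<delta> * (\<Sum>k\<le>n. y k))"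
    by (simp add: pochhammer_Suc_prod atLeast0AtMost prod_norm[symmetric] prod_power_distrib
        prod.distrib exp_sum sum_distrib_left)
  also have "\<dots> \<le> (norm (pochhammer (Complex b T) (Suc n)))\<^sup>2 * exp (\<delta> * (L (Suc n) - 2 * ln T + 2 * C))"
    using sum_y \<delta> by (intro mult_left_mono) (auto intro: mult_left_mono)
  also have "\<dots> = (norm (pochhammer (Complex b T) (Suc n)) * exp (\<delta> * (L (Suc n) / 2 - ln T + C)))\<^sup>2"
    by (simp add: power_mult_distrib exp_double[symmetric] algebra_simps)
  finally show ?thesis
    by (rule power2_le_imp_le[THEN order_trans]) (auto simp: L_def algebra_simps)
qed

text \<open>
  A uniform form of \<open>\<bar>\<Gamma>(b + \<delta> + i T)\<bar> \<approx> T\<^sup>\<delta> \<bar>\<Gamma>(b + i T)\<bar>\<close>, in the direction used below. The estimate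
  for the Pochhammer symbols passes to the limit in Euler's product, where the growing terms \<open>ln n\<close>
  cancel. The exponent must be proportional to \<open>\<delta>\<close>, since the lemma
  is applied with \<open>\<delta>\<close> of order \<open>1 / ln T\<close>, where a bounded factor would destroy the result.
\<close>

lemma norm_Gamma_quotient_le:
  fixes b T \<delta> m :: real
  assumes b: "\<bar>b\<bar> \<le> m" and T: "T \<ge> 4" and \<delta>: "0 \<le> \<delta>" "\<delta> \<le> 1"
  defines "C \<equiv> 16 * (1 + m)\<^sup>2 * (pi\<^sup>2 / 6)"
  shows "norm (Gamma (Complex b T) / Gamma (Complex (b + \<delta>) T)) \<le> exp (- \<delta> * (ln T - C))"
proof -
  define E where "E n = exp (\<delta> * (ln ((b + real n + 1)\<^sup>2 + T\<^sup>2) / 2 - ln (real n) - ln T + C))" for n :: nat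
  have "norm (rGamma_series (Complex (b + \<delta>) T) n) \<le> norm (rGamma_series (Complex b T) n) * E n" for n
  proof -
    have "norm (rGamma_series (Complex (b + \<delta>) T) n) =
          norm (pochhammer (Complex (b + \<delta>) T) (Suc n)) / (fact n * exp ((b + \<delta>) * ln (real n)))"
      by (simp add: rGamma_series_def norm_divide norm_mult)
    also have "\<dots> \<le> norm (pochhammer (Complex b T) (Suc n)) *
           exp (\<delta> * (ln ((b + real n + 1)\<^sup>2 + T\<^sup>2) / 2 - ln T + C)) / (fact n * exp ((b + \<delta>) * ln (real n)))"
      unfolding C_def by (intro divide_right_mono norm_pochhammer_shift_le b T \<delta>) auto
    also have "\<dots> = norm (pochhammer (Complex b T) (Suc n)) / (fact n * exp (b * ln (real n))) * E n"
      by (simp add: E_def exp_add exp_diff ring_distribs)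
    also have "\<dots> = norm (rGamma_series (Complex b T) n) * E n"
      by (simp add: rGamma_series_def norm_divide norm_mult)
    finally show ?thesis .
  qed
  moreover have "E \<longlonglongrightarrow> exp (- \<delta> * (ln T - C))"
  proof -
    have "(\<lambda>n. ln ((b + real n + 1)\<^sup>2 + T\<^sup>2) / 2 - ln (real n)) \<longlonglongrightarrow> 0"
      by real_asymp
    then have "E \<longlonglongrightarrow> exp (\<delta> * (0 - ln T + C))"
      unfolding E_def by (intro tendsto_intros)
    then show ?thesis by (simp add: algebra_simps)
  qed
  ultimately have le: "norm (rGamma (Complex (b + \<delta>) T)) \<le> norm (rGamma (Complex b T)) * exp (- \<delta> * (ln T - C))"
    by (intro LIMSEQ_le[OF tendsto_norm[OF rGamma_series_LIMSEQ] tendsto_mult[OF tendsto_norm[OF rGamma_series_LIMSEQ]]]) auto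
  have "Complex b T \<notin> \<int>\<^sub>\<le>\<^sub>0" using T by (auto elim!: nonpos_Ints_cases simp: complex_eq_iff)
  then have "rGamma (Complex b T) \<noteq> 0" by (simp add: rGamma_eq_zero_iff)
  then show ?thesis
    using le by (simp add: Gamma_def norm_divide norm_inverse field_simps)
qed

section \<open>The factor of the functional equation near the critical line\<close>

text \<open>
  The numerator is the conjugate of a Gamma value on the same horizontal line as the denominator, at
  distance \<open>\<delta> = 2 l / ln x\<close> to its left. The previous estimate gives the bound
  \<open>exp (- \<delta> (ln T - C))\<close> for some \<open>T\<close> with \<open>ln T \<sim> ln x\<close>, so the exponent tends to \<open>- 2 l\<close>.
\<close>

lemma Gamma_factor_bound:
  fixes l :: real and \<mu> :: complex
  assumes "l > 0"
  shows "\<exists>B. (B \<longlongrightarrow> exp (- 2 * l)) at_top \<and>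
    (\<forall>\<^sub>F x in at_top. let s = Complex (1/2 + 1 / ln x) x in
       norm (Gamma (of_real l * (1 - s) + cnj \<mu>) / Gamma (of_real l * s + \<mu>)) \<le> B x)"
proof -
  define A where "A = l / 2 + Re \<mu>"
  define m where "m = \<bar>A\<bar> + 1"
  define C where "C = 16 * (1 + m)\<^sup>2 * (pi\<^sup>2 / 6)"
  define B where "B x = exp (- (2 * l / ln x) * (ln (l * x + Im \<mu>) - C))" for x
  have "(B \<longlongrightarrow> exp (- 2 * l)) at_top"
    unfolding B_def using assms by real_asymp
  moreover have "\<forall>\<^sub>F x in at_top. let s = Complex (1/2 + 1 / ln x) x in
       norm (Gamma (of_real l * (1 - s) + cnj \<mu>) / Gamma (of_real l * s + \<mu>)) \<le> B x"
  proof -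
    have "\<forall>\<^sub>F x in at_top. 2 * l / ln x < 1" "\<forall>\<^sub>F x in at_top. l * x + Im \<mu> \<ge> 4" "\<forall>\<^sub>F x in at_top. ln x > (0::real)"
      using assms by real_asymp+
    then show ?thesis
    proof eventually_elim
      case (elim x)
      define s where "s = Complex (1/2 + 1 / ln x) x"
      define \<delta> where "\<delta> = 2 * l / ln x"
      define T where "T = l * x + Im \<mu>"
      have \<delta>: "0 \<le> \<delta>" "\<delta> \<le> 1" using elim assms by (auto simp: \<delta>_def)
      have 1: "of_real l * (1 - s) + cnj \<mu> = cnj (Complex (A - \<delta> / 2) T)"
        by (simp add: complex_eq_iff s_def A_def T_def \<delta>_def algebra_simps)
      have 2: "of_real l * s + \<mu> = Complex (A - \<delta> / 2 + \<delta>) T"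
        by (simp add: complex_eq_iff s_def A_def T_def \<delta>_def algebra_simps)
      have "norm (Gamma (of_real l * (1 - s) + cnj \<mu>) / Gamma (of_real l * s + \<mu>)) =
            norm (Gamma (Complex (A - \<delta> / 2) T) / Gamma (Complex (A - \<delta> / 2 + \<delta>) T))"
        unfolding 1 2 by (simp add: norm_divide cnj_Gamma[symmetric])
      also have "\<dots> \<le> exp (- \<delta> * (ln T - C))"
        unfolding C_def by (rule norm_Gamma_quotient_le) (use \<delta> elim in \<open>auto simp: m_def T_def\<close>)
      also have "\<dots> = B x" by (simp add: B_def \<delta>_def T_def)
      finally show ?case by (simp add: s_def Let_def)
    qed
  qed
  ultimately show ?thesis by blast
qed

lemma fe_Delta_bound:
  assumes "admissible p"
  shows "\<exists>B. (B \<longlongrightarrow> exp (- param_degree p)) at_top \<and>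
    (\<forall>\<^sub>F x in at_top. norm (fe_Delta p (Complex (1/2 + 1 / ln x) x)) \<le> B x)"
proof -
  let ?J = "{1..par_f p}"
  let ?s = "\<lambda>x. Complex (1/2 + 1 / ln x) x"
  let ?\<gamma> = "\<lambda>j s. Gamma (of_real (par_lambda p j) * (1 - s) + cnj (par_mu p j)) /
                  Gamma (of_real (par_lambda p j) * s + par_mu p j)"
  have Q: "par_Q p > 0" and om: "norm (par_omega p) = 1"
    using assms by (auto simp: admissible_def)
  have "\<forall>j\<in>?J. \<exists>B. (B \<longlongrightarrow> exp (- 2 * par_lambda p j)) at_top \<and> (\<forall>\<^sub>F x in at_top. norm (?\<gamma> j (?s x)) \<le> B x)"
    using Gamma_factor_bound assms by (simp add: admissible_def Let_def)
  from bchoice[OF this] obtain B where B: "\<forall>j\<in>?J. (B j \<longlongrightarrow> exp (- 2 * par_lambda p j)) at_top \<and>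
      (\<forall>\<^sub>F x in at_top. norm (?\<gamma> j (?s x)) \<le> B j x)" ..
  have B_lim: "(B j \<longlongrightarrow> exp (- 2 * par_lambda p j)) at_top"
    and B_bound: "\<forall>\<^sub>F x in at_top. norm (?\<gamma> j (?s x)) \<le> B j x" if "j \<in> ?J" for j
    using bspec[OF B that] by blast+
  define D where "D x = par_Q p powr (- 2 / ln x) * (\<Prod>j\<in>?J. B j x)" for x
  have "(D \<longlongrightarrow> 1 * (\<Prod>j\<in>?J. exp (- 2 * par_lambda p j))) at_top"
    unfolding D_def
  proof (intro tendsto_mult tendsto_prod B_lim)
    show "((\<lambda>x. par_Q p powr (- 2 / ln x)) \<longlongrightarrow> 1) at_top"
      using Q by real_asymp
  qed
  also have "1 * (\<Prod>j\<in>?J. exp (- 2 * par_lambda p j)) = exp (- param_degree p)"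
    by (simp add: param_degree_def exp_sum sum_distrib_left sum_negf[symmetric])
  finally have "(D \<longlongrightarrow> exp (- param_degree p)) at_top" .
  moreover have "\<forall>\<^sub>F x in at_top. norm (fe_Delta p (?s x)) \<le> D x"
  proof -
    have "\<forall>\<^sub>F x in at_top. \<forall>j\<in>?J. norm (?\<gamma> j (?s x)) \<le> B j x"
      using B_bound by (intro eventually_ball_finite) auto
    then show ?thesis
    proof eventually_elim
      case (elim x)
      have "norm (fe_Delta p (?s x)) = par_Q p powr (- 2 / ln x) * (\<Prod>j\<in>?J. norm (?\<gamma> j (?s x)))"
        unfolding fe_Delta_def norm_mult om prod_norm[symmetric]
        using Q by (simp add: norm_powr_real_powr)
      also have "\<dots> \<le> D x"
        unfolding D_def using elim by (intro mult_left_mono prod_mono) auto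
      finally show ?case .
    qed
  qed
  ultimately show ?thesis by blast
qed

text \<open>
  The condition keeps the arguments of all Gamma functions off the real axis, hence off the poles.
\<close>

lemma isCont_fe_Delta:
  assumes "admissible p" and im: "\<And>j. j \<in> {1..par_f p} \<Longrightarrow> par_lambda p j * Im s + Im (par_mu p j) \<noteq> 0"
  shows "isCont (fe_Delta p) s"
proof -
  have non_int: "z \<notin> \<int>\<^sub>\<le>\<^sub>0" if "Im z \<noteq> 0" for z :: complex
    using that by (auto elim!: nonpos_Ints_cases)
  have Q: "par_Q p > 0" using assms by (simp add: admissible_def)
  have "isCont (\<lambda>s. par_omega p * exp ((1 - 2 * s) * Ln (of_real (par_Q p))) *
     (\<Prod>j\<in>{1..par_f p}. Gamma (of_real (par_lambda p j) * (1 - s) + cnj (par_mu p j)) /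
                         Gamma (of_real (par_lambda p j) * s + par_mu p j))) s"
  proof (intro continuous_intros non_int)
    fix j assume j: "j \<in> {1..par_f p}"
    show "Im (of_real (par_lambda p j) * (1 - s) + cnj (par_mu p j)) \<noteq> 0"
      using im[OF j] by (simp add: algebra_simps)
    show "Im (of_real (par_lambda p j) * s + par_mu p j) \<noteq> 0"
      using im[OF j] by (simp add: algebra_simps)
    then show "Gamma (of_real (par_lambda p j) * s + par_mu p j) \<noteq> 0"
      using non_int by (simp add: Gamma_eq_zero_iff)
  qed
  then show ?thesis
    using Q by (simp add: fe_Delta_def[abs_def] powr_def)
qed

section \<open>Omitted values and asymptotic constancy\<close>

text \<open>
  A Landau--Liouville principle for discs that become large compared with the distance of \<open>z\<^sub>n\<close> to the
  centre. After rescaling to the unit disc, Schottky's theorem bounds the functions on the disc of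
  radius \<open>1/2\<close> in terms of their values at the centre, which are bounded because they converge. The
  Schwarz lemma turns this bound into a uniform Lipschitz estimate at the centre, and the rescaled
  points tend to the centre.
\<close>

lemma omits_two_values_tendsto:
  fixes h :: "complex \<Rightarrow> complex" and c z :: "nat \<Rightarrow> complex" and \<rho> :: "nat \<Rightarrow> real"
  assumes holo: "\<And>n. h holomorphic_on ball (c n) (\<rho> n)" and \<rho>: "\<And>n. \<rho> n > 0"
    and omit: "\<And>n w. w \<in> ball (c n) (\<rho> n) \<Longrightarrow> h w \<noteq> p \<and> h w \<noteq> q" and "p \<noteq> q"
    and lim: "(\<lambda>n. h (c n)) \<longlonglongrightarrow> l"
    and z: "(\<lambda>n. norm (z n - c n) / \<rho> n) \<longlonglongrightarrow> 0"
  shows "(\<lambda>n. h (z n)) \<longlonglongrightarrow> l"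
proof -
  define N where "N w = (w - p) / (q - p)" for w
  \<comment> \<open>Half of the radius, since Schottky's theorem is stated for the closed disc.\<close>
  define f where "f n w = N (h (c n + of_real (\<rho> n / 2) * w))" for n w
  have in_ball: "c n + of_real (\<rho> n / 2) * w \<in> ball (c n) (\<rho> n)" if "norm w \<le> 1" for n w
  proof -
    have "norm w * \<rho> n \<le> 1 * \<rho> n" using that \<rho>[of n] by (intro mult_right_mono) auto
    then show ?thesis using \<rho>[of n] by (simp add: dist_norm norm_mult)
  qed
  have "(\<lambda>n. N (h (c n))) \<longlonglongrightarrow> N l"
    unfolding N_def using \<open>p \<noteq> q\<close> by (intro tendsto_intros lim) auto
  then have "Bseq (\<lambda>n. N (h (c n)))"
    using convergentI convergent_imp_Bseq by blast
  then obtain r where r: "\<And>n. norm (N (h (c n))) \<le> r"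
    by (auto simp: Bseq_def)
  define M where "M = exp (pi * exp (pi * (2 + 2 * r + 12 * (1/2) / (1 - 1/2))))"
  have "M > 0" by (simp add: M_def)
  have f_holo: "f n holomorphic_on cball 0 1" for n
  proof -
    have "(h \<circ> (\<lambda>w. c n + of_real (\<rho> n / 2) * w)) holomorphic_on cball 0 1"
      by (rule holomorphic_on_compose_gen[OF _ holo[of n]]) (use in_ball in \<open>auto intro!: holomorphic_intros\<close>)
    then show ?thesis unfolding f_def N_def o_def using \<open>p \<noteq> q\<close> by (intro holomorphic_intros) auto
  qed
  have f_bound: "norm (f n w) \<le> M" if "norm w \<le> 1/2" for n w
    unfolding M_def
  proof (rule Schottky[OF f_holo])
    show "norm (f n 0) \<le> r" using r by (simp add: f_def)
    show "\<not> (f n w = 0 \<or> f n w = 1)" if "w \<in> cball 0 1" for w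
      using omit[OF in_ball[of w n]] that \<open>p \<noteq> q\<close> by (auto simp: f_def N_def)
  qed (use that in auto)
  have f_lip: "norm (f n w - f n 0) \<le> (2 * M + 1) * (2 * norm w)" if "norm w < 1/2" for n w
  proof -
    define g where "g w = (f n (w / 2) - f n 0) / of_real (2 * M + 1)" for w
    have "norm (g (2 * w)) \<le> norm (2 * w)"
    proof (rule Schwarz_Lemma(1))
      have "(f n \<circ> (\<lambda>w. w / 2)) holomorphic_on ball 0 1"
        by (rule holomorphic_on_compose_gen[OF _ f_holo[of n]]) (auto intro!: holomorphic_intros)
      then show "g holomorphic_on ball 0 1"
        unfolding g_def o_def using \<open>M > 0\<close>
        by (intro holomorphic_intros) (auto simp del: of_real_add of_real_mult simp: of_real_eq_0_iff)
      show "g 0 = 0" by (simp add: g_def)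
      show "norm (g v) < 1" if "norm v < 1" for v
      proof -
        have "norm (f n (v / 2) - f n 0) \<le> M + M"
          using f_bound[of "v / 2" n] f_bound[of 0 n] that norm_triangle_ineq4[of "f n (v / 2)" "f n 0"]
          by (simp add: norm_divide)
        then show ?thesis using \<open>M > 0\<close>
          by (simp add: g_def norm_divide del: of_real_add of_real_mult)
      qed
      show "norm (2 * w) < 1" using that by (simp add: norm_mult)
    qed
    then show ?thesis using \<open>M > 0\<close>
      by (simp add: g_def norm_divide norm_mult field_simps del: of_real_add of_real_mult)
  qed
  have "(\<lambda>n. h (z n) - h (c n)) \<longlonglongrightarrow> 0"
  proof (rule Lim_null_comparison)
    show "\<forall>\<^sub>F n in sequentially. norm (h (z n) - h (c n)) \<le>
        norm (q - p) * ((2 * M + 1) * (4 * (norm (z n - c n) / \<rho> n)))"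
    proof -
      have "\<forall>\<^sub>F n in sequentially. norm (z n - c n) / \<rho> n < 1/4"
        using order_tendstoD(2)[OF z, of "1/4"] by simp
      then show ?thesis
      proof eventually_elim
        case (elim n)
        define w where "w = (z n - c n) / of_real (\<rho> n / 2)"
        have w: "norm w = 2 * (norm (z n - c n) / \<rho> n)"
          using \<rho>[of n] by (simp add: w_def norm_divide del: of_real_divide)
        have "c n + of_real (\<rho> n / 2) * w = z n"
          using \<rho>[of n] by (simp add: w_def del: of_real_divide)
        then have "h (z n) - h (c n) = (q - p) * (f n w - f n 0)"
          using \<open>p \<noteq> q\<close> by (simp add: f_def N_def diff_divide_distrib[symmetric] del: of_real_divide)
        also have "norm \<dots> \<le> norm (q - p) * ((2 * M + 1) * (2 * norm w))"
          unfolding norm_mult using elim by (intro mult_left_mono f_lip) (auto simp: w mult.commute)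
        finally show ?case by (simp add: w)
      qed
    qed
    show "(\<lambda>n. norm (q - p) * ((2 * M + 1) * (4 * (norm (z n - c n) / \<rho> n)))) \<longlonglongrightarrow> 0"
      by (intro tendsto_mult_right_zero z)
  qed
  from tendsto_add[OF this lim] show ?thesis by simp
qed

text \<open>
  The meromorphic function \<open>1 / (g - v)\<close>, with its removable singularities at the poles of \<open>g\<close> removed.
  It moves an omitted value \<open>v\<close> to \<open>\<infinity>\<close> and so makes the function holomorphic.
\<close>

definition inverse_shift :: "(complex \<Rightarrow> complex) \<Rightarrow> complex \<Rightarrow> complex \<Rightarrow> complex" where
  "inverse_shift g v s = (if is_pole g s then 0 else 1 / (g s - v))"

lemma inverse_shift_holomorphic:
  assumes mero: "g nicely_meromorphic_on A" and "open A"
    and omit: "\<And>s. s \<in> A \<Longrightarrow> ext_value g s \<noteq> Some v"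
  shows "inverse_shift g v holomorphic_on A"
proof -
  have "inverse_shift g v analytic_on {s}" if "s \<in> A" for s
  proof (cases "is_pole g s")
    case False
    then have an: "g analytic_on {s}"
      using mero that by (intro nicely_meromorphic_on_imp_analytic_at)
    have "g s \<noteq> v" using omit[OF that] False by (simp add: ext_value_def)
    then have "(\<lambda>s. 1 / (g s - v)) analytic_on {s}"
      using an by (auto intro!: analytic_intros)
    moreover have "\<forall>\<^sub>F w in nhds s. inverse_shift g v w = 1 / (g w - v)"
    proof -
      obtain B where B: "open B" "s \<in> B" "g holomorphic_on B"
        using an by (auto simp: analytic_at)
      then have "\<not> is_pole g w" if "w \<in> B" for w
        using not_is_pole_holomorphic that by blast
      then show ?thesis using B unfolding eventually_nhds
        by (auto simp: inverse_shift_def intro!: exI[of _ B])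
    qed
    ultimately show ?thesis using analytic_at_cong[of "inverse_shift g v" _ s s] by simp
  next
    case True
    have mero_s: "g meromorphic_on {s}"
      using mero that meromorphic_on_subset[of g A "{s}"] by (auto simp: nicely_meromorphic_on_def)
    have nonpole: "\<forall>\<^sub>F w in at s. \<not> is_pole g w"
      using meromorphic_on_imp_not_pole_cosparse[OF mero_s] eventually_cosparse_imp_eventually_at by blast
    have ev: "\<forall>\<^sub>F w in at s. inverse_shift g v w = 1 / (g w - v)"
      using nonpole by eventually_elim (simp add: inverse_shift_def)
    have "(\<lambda>w. 1 / (g w - v)) meromorphic_on {s}"
      using mero_s by (auto intro!: meromorphic_intros)
    then have "inverse_shift g v meromorphic_on {s}"
      using meromorphic_on_cong[of "{s}" "inverse_shift g v" "\<lambda>w. 1 / (g w - v)" "{s}"] ev by simp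
    moreover have "isCont (inverse_shift g v) s"
    proof -
      have "filterlim (\<lambda>w. g w - v) at_infinity (at s)"
        using tendsto_add_filterlim_at_infinity'[OF True[unfolded is_pole_def] tendsto_const[of "-v"]] by simp
      then have "((\<lambda>w. 1 / (g w - v)) \<longlongrightarrow> 0) (at s)"
        using tendsto_inverse_0 filterlim_compose by (simp add: divide_inverse) blast
      then have "(inverse_shift g v \<longlongrightarrow> 0) (at s)"
        using tendsto_cong[OF ev] by blast
      then show ?thesis using True by (simp add: isCont_def inverse_shift_def)
    qed
    ultimately show ?thesis by (rule meromorphic_at_isCont_imp_analytic)
  qed
  then show ?thesis
    by (meson analytic_imp_holomorphic analytic_on_analytic_at)
qed

text \<open>
  The same Moebius transformation on the extended plane; it tells which values \<open>inverse_shift g v\<close> omits.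
\<close>

fun inverse_shift_value :: "complex \<Rightarrow> complex option \<Rightarrow> complex" where
  "inverse_shift_value v None = 0"
| "inverse_shift_value v (Some u) = 1 / (u - v)"

lemma inverse_shift_eq: "inverse_shift g v s = inverse_shift_value v (ext_value g s)"
  by (simp add: inverse_shift_def ext_value_def)

lemma inverse_shift_value_inj: "inj_on (inverse_shift_value v) (- {Some v})"
proof (rule inj_onI)
  fix x y assume "x \<in> - {Some v}" "y \<in> - {Some v}" "inverse_shift_value v x = inverse_shift_value v y"
  then show "x = y" by (cases x; cases y) (auto simp: field_simps)
qed

text \<open>
  Of three values of the extended plane at least one, \<open>v\<close>, is neither \<open>\<infinity>\<close> nor the limit \<open>w0\<close>. Then
  \<open>1 / (g - v)\<close> is holomorphic, omits the images of the other two values and has a finite limit along the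
  centres, so \<open>omits_two_values_tendsto\<close> applies to it. Its limit is not \<open>0\<close>, and therefore the
  conclusion can be transferred back to \<open>g\<close>. The limit \<open>w0\<close> itself may be one of the omitted values.
\<close>

lemma omits_three_values_tendsto:
  fixes g :: "complex \<Rightarrow> complex" and c z :: "nat \<Rightarrow> complex" and \<rho> :: "nat \<Rightarrow> real"
  assumes mero: "\<And>n. g nicely_meromorphic_on ball (c n) (\<rho> n)" and \<rho>: "\<And>n. \<rho> n > 0"
    and X: "card X = 3" and omit: "\<And>n s. s \<in> ball (c n) (\<rho> n) \<Longrightarrow> ext_value g s \<notin> X"
    and nonpole: "\<And>n. \<not> is_pole g (c n)" and lim: "(\<lambda>n. g (c n)) \<longlonglongrightarrow> w0"
    and z: "(\<lambda>n. norm (z n - c n) / \<rho> n) \<longlonglongrightarrow> 0"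
  shows "\<forall>\<^sub>F n in sequentially. \<not> is_pole g (z n)" and "(\<lambda>n. g (z n)) \<longlonglongrightarrow> w0"
proof -
  have "finite X" using X card.infinite by fastforce
  have "card (X - {None, Some w0}) \<noteq> 0"
    using diff_card_le_card_Diff[of "{None, Some w0}" X] X by simp
  then obtain v where v: "Some v \<in> X" "v \<noteq> w0" 
    by (metis Diff_iff card.empty equals0I insertCI not_None_eq)
  have "card (X - {Some v}) = 2" using X v \<open>finite X\<close> by simp
  then obtain a b where ab: "X - {Some v} = {a, b}" "a \<noteq> b" by (auto simp: card_2_iff)
  let ?h = "inverse_shift g v" and ?l = "1 / (w0 - v)"
  have nz: "?l \<noteq> 0" using v by simp
  have h_lim: "(\<lambda>n. ?h (z n)) \<longlonglongrightarrow> ?l"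
  proof (rule omits_two_values_tendsto[where h = ?h and p = "inverse_shift_value v a" and q = "inverse_shift_value v b"])
    show "?h holomorphic_on ball (c n) (\<rho> n)" for n
      using omit v by (intro inverse_shift_holomorphic mero open_ball) metis
    show "?h w \<noteq> inverse_shift_value v a \<and> ?h w \<noteq> inverse_shift_value v b"
      if "w \<in> ball (c n) (\<rho> n)" for n w
      using omit[OF that] v ab inj_onD[OF inverse_shift_value_inj[of v], of "ext_value g w"]
      unfolding inverse_shift_eq by (metis (no_types, lifting) ComplI Diff_iff insertCI singletonD)
    show "inverse_shift_value v a \<noteq> inverse_shift_value v b"
      using ab inj_onD[OF inverse_shift_value_inj[of v], of a b] by blast
    show "(\<lambda>n. ?h (c n)) \<longlonglongrightarrow> ?l"
      using nonpole v by (auto simp: inverse_shift_def intro!: tendsto_intros lim)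
  qed (use \<rho> z in auto)
  have ev: "\<forall>\<^sub>F n in sequentially. ?h (z n) \<noteq> 0"
    using tendsto_imp_eventually_ne[OF h_lim nz] .
  then show "\<forall>\<^sub>F n in sequentially. \<not> is_pole g (z n)"
    by eventually_elim (auto simp: inverse_shift_def)
  have "(\<lambda>n. v + 1 / ?h (z n)) \<longlonglongrightarrow> v + 1 / ?l"
    using nz by (intro tendsto_intros h_lim)
  moreover have "\<forall>\<^sub>F n in sequentially. v + 1 / ?h (z n) = g (z n)"
    using ev by eventually_elim (auto simp: inverse_shift_def split: if_splits)
  ultimately show "(\<lambda>n. g (z n)) \<longlonglongrightarrow> w0"
    using tendsto_cong by fastforce
qed

section \<open>Values near a sequence on the critical line\<close>

text \<open>
  The functional equation is given off a set without limit points. By continuity it extends to each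
  point at which all functions involved are regular.
\<close>

lemma functional_equation_at_regular_point:
  assumes mero: "G nicely_meromorphic_on half_strip" and fe: "functional_equation p G"
    and s: "s \<in> half_strip" and np: "\<not> is_pole G s" "\<not> is_pole G (1 - cnj s)"
    and cont: "isCont (fe_Delta p) s"
  shows "G s = fe_Delta p s * cnj (G (1 - cnj s))"
proof (rule tendsto_unique)
  have "1 - cnj s \<in> half_strip" using s by (simp add: half_strip_def)
  then have c1: "isCont G s" and c2: "isCont G (1 - cnj s)"
    using mero s np nicely_meromorphic_on_imp_analytic_at analytic_at_imp_isCont by blast+
  show "(G \<longlongrightarrow> G s) (at s)" using c1 by (simp add: isCont_def)
  have "isCont (\<lambda>w. G (1 - cnj w)) s"
    by (rule isCont_o2[where g = G]) (intro continuous_intros c2)+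
  then have "isCont (\<lambda>w. fe_Delta p w * cnj (G (1 - cnj w))) s"
    by (intro continuous_intros cont)
  then have "((\<lambda>w. fe_Delta p w * cnj (G (1 - cnj w))) \<longlongrightarrow> fe_Delta p s * cnj (G (1 - cnj s))) (at s)"
    by (simp add: isCont_def)
  moreover have "\<forall>\<^sub>F w in at s. G w = fe_Delta p w * cnj (G (1 - cnj w))"
    using fe s unfolding functional_equation_def by (rule eventually_cosparse_imp_eventually_at)
  ultimately show "(G \<longlongrightarrow> fe_Delta p s * cnj (G (1 - cnj s))) (at s)"
    using tendsto_cong by fast
qed auto

lemma nicely_meromorphic_nonzero_imp_not_pole:
  assumes "f nicely_meromorphic_on A" "z \<in> A" "f z \<noteq> 0"
  shows "\<not> is_pole f z"
  using assms not_tendsto_and_filterlim_at_infinity[of "at z" f]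
  unfolding nicely_meromorphic_on_def is_pole_def by auto

lemma ball_subset_half_strip:
  assumes "t \<ge> 1" "r \<le> 1/2"
  shows "ball (Complex (1/2) t) r \<subseteq> half_strip"
proof
  fix z assume "z \<in> ball (Complex (1/2) t) r"
  then have "norm (z - Complex (1/2) t) < 1/2"
    using assms by (simp add: dist_norm norm_minus_commute)
  then have "\<bar>Re z - 1/2\<bar> < 1/2" "\<bar>Im z - t\<bar> < 1/2"
    using abs_Re_le_cmod[of "z - Complex (1/2) t"] abs_Im_le_cmod[of "z - Complex (1/2) t"] by auto
  then show "z \<in> half_strip" using assms unfolding half_strip_def by (intro CollectI conjI) linarith+
qed

text \<open>
  The contradiction that proves the theorem. Infinitely many \<open>k\<close> for each
  \<open>R\<close>, rather than almost all, is the form that suits discs about a subsequence of the points.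
\<close>

lemma critical_line_sequence_takes_value:
  fixes G :: "complex \<Rightarrow> complex" and \<tau> :: "nat \<Rightarrow> real"
  assumes G: "G \<in> class_G" and deg: "degree_G G > 0"
    and \<tau>: "filterlim \<tau> at_top sequentially"
    and \<alpha>: "\<alpha> > 0" "(\<lambda>k. norm (G (Complex (1/2) (\<tau> k)))) \<longlonglongrightarrow> \<alpha>"
    and E: "\<And>R. R > 0 \<Longrightarrow>
      \<exists>\<^sub>F k in sequentially. half_strip \<inter> ball (Complex (1/2) (\<tau> k)) (R / ln (\<tau> k)) \<subseteq> E"
    and X: "card X = 3"
  shows "\<exists>z\<in>E. ext_value G z \<in> X"
proof (rule ccontr)
  assume "\<not> (\<exists>z\<in>E. ext_value G z \<in> X)"
  then have omit: "ext_value G z \<notin> X" if "z \<in> E" for z using that by blast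
  have mero: "G nicely_meromorphic_on half_strip" using G by (simp add: class_G_def)
  define p where "p = (SOME p. admissible p \<and> functional_equation p G)"
  have "\<exists>p. admissible p \<and> functional_equation p G" using G by (simp add: class_G_def)
  then have "admissible p \<and> functional_equation p G" unfolding p_def by (rule someI_ex)
  then have adm: "admissible p" and fe: "functional_equation p G" by auto
  have deg_p: "param_degree p > 0" using deg by (simp add: degree_G_def p_def)
  let ?s = "\<lambda>t. Complex (1/2) t"

  have good: "\<forall>\<^sub>F k in sequentially. \<tau> k > 1 \<and> R / ln (\<tau> k) \<le> 1/2 \<and> \<not> is_pole G (?s (\<tau> k))" for R
  proof -
    have "\<forall>\<^sub>F x :: real in at_top. R / ln x < 1/2" by real_asymp
    then have "\<forall>\<^sub>F k in sequentially. R / ln (\<tau> k) < 1/2"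
      using \<tau> by (rule eventually_compose_filterlim)
    moreover have "\<forall>\<^sub>F k in sequentially. \<tau> k > 1"
      using \<tau> by (simp add: filterlim_at_top_dense)
    moreover have "\<forall>\<^sub>F k in sequentially. norm (G (?s (\<tau> k))) \<noteq> 0"
      using tendsto_imp_eventually_ne[OF \<alpha>(2), of 0] \<alpha>(1) by simp
    ultimately show ?thesis
    proof eventually_elim
      case (elim k)
      then show ?case
        using nicely_meromorphic_nonzero_imp_not_pole[OF mero, of "?s (\<tau> k)"] by (simp add: half_strip_def)
    qed
  qed
  \<comment> \<open>A diagonal choice: the radius of the n-th disc is n + 1 in the unit 1 / ln \<tau>.\<close>
  have "\<exists>k\<ge>n. ball (?s (\<tau> k)) ((real n + 1) / ln (\<tau> k)) \<subseteq> half_strip \<inter> E \<and> \<tau> k > 1 \<and> \<not> is_pole G (?s (\<tau> k))" for n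
  proof -
    have "\<exists>\<^sub>F k in sequentially. half_strip \<inter> ball (?s (\<tau> k)) ((real n + 1) / ln (\<tau> k)) \<subseteq> E"
      by (rule E) simp
    then have "\<exists>\<^sub>F k in sequentially. ball (?s (\<tau> k)) ((real n + 1) / ln (\<tau> k)) \<subseteq> half_strip \<inter> E
        \<and> \<tau> k > 1 \<and> \<not> is_pole G (?s (\<tau> k))"
      using good[of "real n + 1"]
    proof (rule frequently_rev_mp[OF _ eventually_mono])
      fix k assume "\<tau> k > 1 \<and> (real n + 1) / ln (\<tau> k) \<le> 1/2 \<and> \<not> is_pole G (?s (\<tau> k))"
      then show "half_strip \<inter> ball (?s (\<tau> k)) ((real n + 1) / ln (\<tau> k)) \<subseteq> E \<longrightarrow>
        ball (?s (\<tau> k)) ((real n + 1) / ln (\<tau> k)) \<subseteq> half_strip \<inter> E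
        \<and> \<tau> k > 1 \<and> \<not> is_pole G (?s (\<tau> k))"
        using ball_subset_half_strip[of "\<tau> k" "(real n + 1) / ln (\<tau> k)"] by auto
    qed
    then show ?thesis unfolding frequently_sequentially by blast
  qed
  then obtain \<kappa> where \<kappa>: "\<And>n. \<kappa> n \<ge> n"
      "\<And>n. ball (?s (\<tau> (\<kappa> n))) ((real n + 1) / ln (\<tau> (\<kappa> n))) \<subseteq> half_strip \<inter> E"
      "\<And>n. \<tau> (\<kappa> n) > 1" "\<And>n. \<not> is_pole G (?s (\<tau> (\<kappa> n)))"
    by metis
  have \<kappa>_lim: "filterlim \<kappa> sequentially sequentially"
    by (rule filterlim_at_top_mono[OF filterlim_ident]) (simp add: \<kappa>)

  \<comment> \<open>Only the moduli of the values at the centres converge; compactness provides a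
      limit of the values themselves.\<close>
  have norm_lim: "(\<lambda>n. norm (G (?s (\<tau> (\<kappa> n))))) \<longlonglongrightarrow> \<alpha>"
    using filterlim_compose[OF \<alpha>(2) \<kappa>_lim] .
  then have "Bseq (\<lambda>n. norm (G (?s (\<tau> (\<kappa> n)))))"
    using convergentI convergent_imp_Bseq by blast
  then have "bounded (range (\<lambda>n. G (?s (\<tau> (\<kappa> n)))))"
    by (auto simp: Bseq_def bounded_iff)
  from bounded_imp_convergent_subsequence[OF this]
  obtain w0 r where r: "strict_mono r" and w0: "((\<lambda>n. G (?s (\<tau> (\<kappa> n)))) \<circ> r) \<longlonglongrightarrow> w0" by blast
  have norm_w0: "norm w0 = \<alpha>"
    using tendsto_norm[OF w0] LIMSEQ_subseq_LIMSEQ[OF norm_lim r]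
    by (intro LIMSEQ_unique) (auto simp: o_def)

  define t where "t n = \<tau> (\<kappa> (r n))" for n
  define \<rho> where "\<rho> n = (real (r n) + 1) / ln (t n)" for n
  have t_gt: "t n > 1" for n using \<kappa> by (simp add: t_def)
  have ln_t: "ln (t n) > 0" for n using t_gt[of n] by simp
  have \<rho>: "\<rho> n > 0" for n unfolding \<rho>_def by (intro divide_pos_pos ln_t) simp
  have ball: "ball (?s (t n)) (\<rho> n) \<subseteq> half_strip \<inter> E" for n
    using \<kappa>(2)[of "r n"] by (simp add: t_def \<rho>_def)
  have t_lim: "filterlim t at_top sequentially"
    unfolding t_def using filterlim_compose[OF \<tau> filterlim_compose[OF \<kappa>_lim filterlim_subseq[OF r]]] .
  \<comment> \<open>Mirror points with respect to the critical line, at distance one in the unit 1 / ln t.\<close>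
  define zp where "zp n = Complex (1/2 + 1 / ln (t n)) (t n)" for n
  define zm where "zm n = Complex (1/2 - 1 / ln (t n)) (t n)" for n
  have zm: "zm n = 1 - cnj (zp n)" for n by (simp add: zm_def zp_def complex_eq_iff)
  have ratio: "norm (zp n - ?s (t n)) / \<rho> n = 1 / (real (r n) + 1)"
              "norm (zm n - ?s (t n)) / \<rho> n = 1 / (real (r n) + 1)" for n
  proof -
    have "zp n - ?s (t n) = of_real (1 / ln (t n))" "zm n - ?s (t n) = - of_real (1 / ln (t n))"
      by (simp_all add: zp_def zm_def complex_eq_iff)
    then have "norm (zp n - ?s (t n)) = 1 / ln (t n)" "norm (zm n - ?s (t n)) = 1 / ln (t n)"
      using ln_t[of n] by (simp_all only: norm_minus_cancel norm_of_real) auto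
    then show "norm (zp n - ?s (t n)) / \<rho> n = 1 / (real (r n) + 1)"
              "norm (zm n - ?s (t n)) / \<rho> n = 1 / (real (r n) + 1)"
      using ln_t[of n] by (simp_all add: \<rho>_def)
  qed
  have "filterlim (\<lambda>n. real (r n)) at_top sequentially"
    using filterlim_compose[OF filterlim_real_sequentially filterlim_subseq[OF r]] .
  then have ratio_lim: "(\<lambda>n. 1 / (real (r n) + 1)) \<longlonglongrightarrow> 0"
    by (rule filterlim_compose[rotated]) real_asymp

  have conv: "\<forall>\<^sub>F n in sequentially. \<not> is_pole G (z n)" "(\<lambda>n. G (z n)) \<longlonglongrightarrow> w0"
    if "(\<lambda>n. norm (z n - ?s (t n)) / \<rho> n) \<longlonglongrightarrow> 0" for z
  proof -
    have mero_ball: "G nicely_meromorphic_on ball (?s (t n)) (\<rho> n)" for n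
      using mero ball nicely_meromorphic_on_subset by blast
    have omit_ball: "ext_value G s \<notin> X" if "s \<in> ball (?s (t n)) (\<rho> n)" for n s
      using that ball omit by blast
    have centre_regular: "\<not> is_pole G (?s (t n))" for n using \<kappa>(4) by (simp add: t_def)
    have centre_lim: "(\<lambda>n. G (?s (t n))) \<longlonglongrightarrow> w0" using w0 by (simp add: o_def t_def)
    show "\<forall>\<^sub>F n in sequentially. \<not> is_pole G (z n)" "(\<lambda>n. G (z n)) \<longlonglongrightarrow> w0"
      using omits_three_values_tendsto[OF mero_ball \<rho> X omit_ball centre_regular centre_lim that] by auto
  qed
  have zp_conv: "\<forall>\<^sub>F n in sequentially. \<not> is_pole G (zp n)" "(\<lambda>n. G (zp n)) \<longlonglongrightarrow> w0"
    and zm_conv: "\<forall>\<^sub>F n in sequentially. \<not> is_pole G (zm n)" "(\<lambda>n. G (zm n)) \<longlonglongrightarrow> w0"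
    by (rule conv; simp only: ratio ratio_lim)+

  obtain B where B: "(B \<longlongrightarrow> exp (- param_degree p)) at_top"
    "\<forall>\<^sub>F x in at_top. norm (fe_Delta p (Complex (1/2 + 1 / ln x) x)) \<le> B x"
    using fe_Delta_bound[OF adm] by blast
  have "\<forall>\<^sub>F x in at_top. \<forall>j\<in>{1..par_f p}. par_lambda p j * x + Im (par_mu p j) \<noteq> 0"
  proof (intro eventually_ball_finite ballI)
    fix j assume "j \<in> {1..par_f p}"
    then have "par_lambda p j > 0" using adm by (simp add: admissible_def)
    then have "\<forall>\<^sub>F x in at_top. par_lambda p j * x + Im (par_mu p j) > 0" by real_asymp
    then show "\<forall>\<^sub>F x in at_top. par_lambda p j * x + Im (par_mu p j) \<noteq> 0"
      by eventually_elim simp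
  qed auto
  then have "\<forall>\<^sub>F x in at_top. isCont (fe_Delta p) (Complex (1/2 + 1 / ln x) x)"
    by eventually_elim (auto intro!: isCont_fe_Delta[OF adm])
  from eventually_compose_filterlim[OF this t_lim]
  have Delta_cont: "\<forall>\<^sub>F n in sequentially. isCont (fe_Delta p) (zp n)" by (simp add: zp_def)
  have Delta_le: "\<forall>\<^sub>F n in sequentially. norm (fe_Delta p (zp n)) \<le> B (t n)"
    using eventually_compose_filterlim[OF B(2) t_lim] by (simp add: zp_def)
  have "\<forall>\<^sub>F n in sequentially. 1 / (real (r n) + 1) < 1"
    using order_tendstoD(2)[OF ratio_lim, of 1] by simp
  then have "\<forall>\<^sub>F n in sequentially. norm (G (zp n)) \<le> B (t n) * norm (G (zm n))"
    using zp_conv(1) zm_conv(1) Delta_cont Delta_le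
  proof eventually_elim
    case (elim n)
    have "norm (zp n - ?s (t n)) < \<rho> n"
      using ratio(1)[of n] elim(1) \<rho>[of n] by (metis divide_less_eq_1_pos)
    then have "zp n \<in> half_strip"
      using ball[of n] by (auto simp: dist_norm norm_minus_commute)
    then have "G (zp n) = fe_Delta p (zp n) * cnj (G (zm n))"
      using functional_equation_at_regular_point[OF mero fe, of "zp n"] elim by (simp add: zm)
    then show ?case using elim by (simp add: norm_mult mult_right_mono)
  qed
  then have "norm w0 \<le> exp (- param_degree p) * norm w0"
    by (intro tendsto_le[OF _ tendsto_mult[OF filterlim_compose[OF B(1) t_lim] tendsto_norm[OF zm_conv(2)]]
          tendsto_norm[OF zp_conv(2)]]) auto
  moreover have "exp (- param_degree p) * \<alpha> < 1 * \<alpha>"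
    using deg_p \<alpha>(1) by (intro mult_strict_right_mono) auto
  ultimately show False by (simp add: norm_w0)
qed

section \<open>From triples of values to Picard properties\<close>

lemma card_le_2_if_no_triple:
  assumes "\<And>X. X \<subseteq> A \<Longrightarrow> card X \<noteq> 3"
  shows "finite A \<and> card A \<le> 2"
proof (rule ccontr)
  assume *: "\<not> (finite A \<and> card A \<le> 2)"
  show False
  proof (cases "finite A")
    case True
    then obtain X where "X \<subseteq> A" "card X = 3"
      using * obtain_subset_with_card_n[of 3 A] by auto
    then show False using assms by blast
  next
    case False
    then obtain X where "X \<subseteq> A" "card X = 3"
      using infinite_arbitrarily_large by blast
    then show False using assms by blast
  qed
qed

lemma picard_property_onI:
  assumes "\<And>X. card X = 3 \<Longrightarrow> \<exists>z\<in>E. ext_value g z \<in> X"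
  shows "picard_property_on g E"
proof -
  let ?A = "{a. \<not> (\<exists>z\<in>E. ext_value g z = a)}"
  have "card X \<noteq> 3" if "X \<subseteq> ?A" for X
    using assms[of X] that by blast
  then have "finite ?A \<and> card ?A \<le> 2" by (rule card_le_2_if_no_triple)
  then show ?thesis unfolding picard_property_on_def by (intro exI[of _ ?A]) blast
qed

text \<open>
  If three values were each taken only finitely often, then all points where they are taken would lie
  below some height \<open>N\<close>, and none of the values would be taken above it.
\<close>

lemma infinitely_often_picard_onI:
  assumes "\<And>X N. card X = 3 \<Longrightarrow> \<exists>z\<in>E. Im z > N \<and> ext_value g z \<in> X"
  shows "infinitely_often_picard_on g E"
proof -
  let ?F = "\<lambda>a. {z\<in>E. ext_value g z = a}"
  let ?A = "{a. finite (?F a)}"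
  have "card X \<noteq> 3" if "X \<subseteq> ?A" for X
  proof
    assume X: "card X = 3"
    then have "finite X" using card.infinite by fastforce
    then have "finite (\<Union>a\<in>X. ?F a)" using that by blast
    then have "bdd_above (Im ` (\<Union>a\<in>X. ?F a))" by simp
    then obtain N where N: "\<And>z. z \<in> (\<Union>a\<in>X. ?F a) \<Longrightarrow> Im z \<le> N"
      by (auto simp: bdd_above_def)
    obtain z where "z \<in> E" "Im z > N" "ext_value g z \<in> X" using assms[OF X] by blast
    then show False using N[of z] by force
  qed
  then have "finite ?A \<and> card ?A \<le> 2" by (rule card_le_2_if_no_triple)
  then show ?thesis unfolding infinitely_often_picard_on_def by (intro exI[of _ ?A]) blast
qed

text \<open>
  A line that stays in a strip is parallel to it. Here this reads \<open>cos \<theta> = 0\<close>, because otherwise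
  \<open>Im (cis (- \<theta>) * s)\<close> takes all real values on the line.
\<close>

lemma open_strip_around_critical_line:
  assumes "open_strip S" "{s. Re s = 1/2} \<subseteq> S"
  obtains \<delta> where "\<delta> > 0" "{s. \<bar>Re s - 1/2\<bar> < \<delta>} \<subseteq> S"
proof -
  obtain \<theta> a b where S: "S = {z. a < Im (cis (- \<theta>) * z) \<and> Im (cis (- \<theta>) * z) < b}"
    using assms by (auto simp: open_strip_def)
  have Im_eq: "Im (cis (- \<theta>) * z) = cos \<theta> * Im z - sin \<theta> * Re z" for z by simp
  have line: "a < cos \<theta> * y - sin \<theta> / 2 \<and> cos \<theta> * y - sin \<theta> / 2 < b" for y
  proof -
    have "Complex (1/2) y \<in> S" using assms by auto
    then show ?thesis unfolding S Im_eq by simp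
  qed
  have cos: "cos \<theta> = 0"
  proof (rule ccontr)
    assume "cos \<theta> \<noteq> 0"
    then show False using line[of "(b + sin \<theta> / 2) / cos \<theta>"] by simp
  qed
  define \<delta> where "\<delta> = min (b + sin \<theta> / 2) (- sin \<theta> / 2 - a)"
  show ?thesis
  proof
    show "\<delta> > 0" using line[of 0] by (simp add: \<delta>_def)
    show "{s. \<bar>Re s - 1/2\<bar> < \<delta>} \<subseteq> S"
    proof
      fix s assume "s \<in> {s. \<bar>Re s - 1/2\<bar> < \<delta>}"
      then have s: "\<bar>Re s - 1/2\<bar> < \<delta>" by simp
      have "\<bar>sin \<theta> * (Re s - 1/2)\<bar> \<le> 1 * \<bar>Re s - 1/2\<bar>"
        unfolding abs_mult by (intro mult_right_mono) auto
      then have "\<bar>sin \<theta> * Re s - sin \<theta> / 2\<bar> < \<delta>" using s by (simp add: algebra_simps)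
      then show "s \<in> S" unfolding S Im_eq cos \<delta>_def by auto
    qed
  qed
qed

lemma complex_line_critical: "complex_line {s. Re s = 1/2}"
  unfolding complex_line_def
proof (intro exI conjI)
  show "{s. Re s = 1/2} = {1/2 + of_real r * cis (pi / 2) | r :: real. True}"
    by (auto simp: complex_eq_iff)
qed auto

section \<open>Filling discs, the Julia line and narrow regions\<close>

theorem theorem4p14:
  fixes G :: "complex \<Rightarrow> complex" and \<tau> :: "nat \<Rightarrow> real" and \<alpha> :: real
  assumes "G \<in> class_G" and "degree_G G > 0"
    and "\<And>k. \<tau> k \<ge> 2" and "filterlim \<tau> at_top sequentially"
    and "\<alpha> > 0"
    and "(\<lambda>k. norm (G (Complex (1/2) (\<tau> k)))) \<longlonglongrightarrow> \<alpha>"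
  shows
    "(\<forall>\<mu> :: real \<Rightarrow> real. (\<forall>t\<ge>2. \<mu> t > 0) \<and> filterlim \<mu> at_top at_top \<longrightarrow>
        filling_discs half_strip G (\<lambda>k. Complex (1/2) (\<tau> k)) (\<lambda>k. \<mu> (\<tau> k) / ln (\<tau> k))) \<and>
     julia_line half_strip G {s. Re s = 1/2} \<and>
     (\<forall>\<mu> :: real \<Rightarrow> real. (\<forall>t\<ge>2. \<mu> t > 0) \<and> filterlim \<mu> at_top at_top \<longrightarrow>
        infinitely_often_picard_on G
          (half_strip \<inter> {s. Im s \<ge> 2 \<and> 1/2 - \<mu> (Im s) / ln (Im s) < Re s \<and>
                            Re s < 1/2 + \<mu> (Im s) / ln (Im s)}))"
proof (intro conjI allI impI)
  note takes_value = critical_line_sequence_takes_value[OF assms(1,2,4,5,6)]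
  have ln_pos: "ln (\<tau> k) > 0" for k using assms(3)[of k] by simp
  have in_ball: "\<bar>Re z - 1/2\<bar> < \<rho> \<and> \<bar>Im z - t\<bar> < \<rho>" if "z \<in> ball (Complex (1/2) t) \<rho>" for z t \<rho>
    using that abs_Re_le_cmod[of "z - Complex (1/2) t"] abs_Im_le_cmod[of "z - Complex (1/2) t"]
    by (auto simp: dist_norm norm_minus_commute)
  have radius_small: "\<forall>\<^sub>F k in sequentially. R / ln (\<tau> k) < \<delta>" if "\<delta> > 0" for R \<delta>
  proof -
    have "\<forall>\<^sub>F x in at_top. R / ln x < \<delta>" using that by real_asymp
    then show ?thesis using assms(4) by (rule eventually_compose_filterlim)
  qed

  fix \<mu> :: "real \<Rightarrow> real"
  assume \<mu>: "(\<forall>t\<ge>2. \<mu> t > 0) \<and> filterlim \<mu> at_top at_top"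

  show "filling_discs half_strip G (\<lambda>k. Complex (1/2) (\<tau> k)) (\<lambda>k. \<mu> (\<tau> k) / ln (\<tau> k))"
    unfolding filling_discs_def
  proof (intro allI impI picard_property_onI takes_value)
    fix \<epsilon> :: real and \<phi> :: "nat \<Rightarrow> nat" and R :: real
    assume "0 < \<epsilon> \<and> \<epsilon> \<le> 1 \<and> strict_mono \<phi>"
    then have \<epsilon>: "\<epsilon> > 0" and \<phi>: "strict_mono \<phi>" by auto
    let ?E = "half_strip \<inter> (\<Union>k. ball (Complex (1/2) (\<tau> (\<phi> k))) (\<epsilon> * (\<mu> (\<tau> (\<phi> k)) / ln (\<tau> (\<phi> k)))))"
    have "filterlim (\<lambda>k. \<mu> (\<tau> (\<phi> k))) at_top sequentially"
      using \<mu> filterlim_compose[OF _ filterlim_compose[OF assms(4) filterlim_subseq[OF \<phi>]]] by blast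
    then have "\<forall>\<^sub>F k in sequentially. \<mu> (\<tau> (\<phi> k)) \<ge> R / \<epsilon>"
      by (simp add: filterlim_at_top)
    then have "\<forall>\<^sub>F k in sequentially. half_strip \<inter> ball (Complex (1/2) (\<tau> (\<phi> k))) (R / ln (\<tau> (\<phi> k))) \<subseteq> ?E"
    proof eventually_elim
      case (elim k)
      then have "R \<le> \<epsilon> * \<mu> (\<tau> (\<phi> k))" using \<epsilon> by (simp add: field_simps)
      then have "R / ln (\<tau> (\<phi> k)) \<le> \<epsilon> * (\<mu> (\<tau> (\<phi> k)) / ln (\<tau> (\<phi> k)))"
        using ln_pos[of "\<phi> k"] by (simp add: divide_right_mono)
      then show ?case by (meson Int_mono UN_upper UNIV_I order.refl order.trans subset_ball)
    qed
    then obtain N where N: "\<And>k. k \<ge> N \<Longrightarrow>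
        half_strip \<inter> ball (Complex (1/2) (\<tau> (\<phi> k))) (R / ln (\<tau> (\<phi> k))) \<subseteq> ?E"
      by (auto simp: eventually_sequentially)
    show "\<exists>\<^sub>F k in sequentially. half_strip \<inter> ball (Complex (1/2) (\<tau> k)) (R / ln (\<tau> k)) \<subseteq> ?E"
      unfolding frequently_sequentially
    proof
      fix M
      have "\<phi> (max N M) \<ge> M" using seq_suble[OF \<phi>, of "max N M"] by linarith
      then show "\<exists>k\<ge>M. half_strip \<inter> ball (Complex (1/2) (\<tau> k)) (R / ln (\<tau> k)) \<subseteq> ?E"
        using N[of "max N M"] by (intro exI[of _ "\<phi> (max N M)"]) auto
    qed
  qed

  show "infinitely_often_picard_on G
          (half_strip \<inter> {s. Im s \<ge> 2 \<and> 1/2 - \<mu> (Im s) / ln (Im s) < Re s \<and>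
                            Re s < 1/2 + \<mu> (Im s) / ln (Im s)})" (is "infinitely_often_picard_on G ?V")
  proof (rule infinitely_often_picard_onI)
    fix X :: "complex option set" and N assume X: "card X = 3"
    have "\<exists>z\<in>?V \<inter> {z. Im z > N}. ext_value G z \<in> X"
    proof (rule takes_value[OF _ X])
      fix R :: real assume "R > 0"
      \<comment> \<open>The shape of the region depends on \<mu> at every height, and \<mu> need not be monotone.
          The factor 2 outweighs the variation of ln over the disc.\<close>
      obtain t0 where t0: "\<And>t. t \<ge> t0 \<Longrightarrow> \<mu> t \<ge> 2 * R"
        using \<mu> unfolding filterlim_at_top eventually_at_top_linorder by blast
      have "\<forall>\<^sub>F k in sequentially. \<tau> k > max 3 (max (t0 + 1) (N + 1))"
        using assms(4) by (simp only: filterlim_at_top_dense)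
      then have "\<forall>\<^sub>F k in sequentially. half_strip \<inter> ball (Complex (1/2) (\<tau> k)) (R / ln (\<tau> k)) \<subseteq> ?V \<inter> {z. Im z > N}"
        using radius_small[of 1 R, OF zero_less_one]
      proof eventually_elim
        case (elim k)
        show ?case
        proof
          fix z assume z: "z \<in> half_strip \<inter> ball (Complex (1/2) (\<tau> k)) (R / ln (\<tau> k))"
          then have "z \<in> ball (Complex (1/2) (\<tau> k)) (R / ln (\<tau> k))" by blast
          then have re: "\<bar>Re z - 1/2\<bar> < R / ln (\<tau> k)" and im: "\<bar>Im z - \<tau> k\<bar> < 1"
            using in_ball[of z "\<tau> k" "R / ln (\<tau> k)"] elim(2) by linarith+
          have \<tau>3: "\<tau> k > 3" using elim by simp
          have "Im z \<le> \<tau> k * \<tau> k"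
            using im \<tau>3 mult_left_mono[of 3 "\<tau> k" "\<tau> k"] by linarith
          then have ln_le: "ln (Im z) \<le> 2 * ln (\<tau> k)" and ln_z: "ln (Im z) > 0"
            using im \<tau>3 ln_mono[of "Im z" "\<tau> k * \<tau> k"] by (auto simp: ln_mult)
          have "R / ln (\<tau> k) = 2 * R / (2 * ln (\<tau> k))" by simp
          also have "\<dots> \<le> 2 * R / ln (Im z)"
            using ln_le ln_z \<open>R > 0\<close> by (intro divide_left_mono) auto
          also have "\<dots> \<le> \<mu> (Im z) / ln (Im z)"
            using ln_z t0[of "Im z"] im elim by (intro divide_right_mono) auto
          finally show "z \<in> ?V \<inter> {z. Im z > N}"
            using z re im elim by (auto simp: abs_if split: if_splits)
        qed
      qed
      then show "\<exists>\<^sub>F k in sequentially. half_strip \<inter> ball (Complex (1/2) (\<tau> k)) (R / ln (\<tau> k)) \<subseteq> ?V \<inter> {z. Im z > N}"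
        by (rule eventually_frequently[rotated]) simp
    qed
    then show "\<exists>z\<in>?V. Im z > N \<and> ext_value G z \<in> X" by blast
  qed
next
  note takes_value = critical_line_sequence_takes_value[OF assms(1,2,4,5,6)]
  show "julia_line half_strip G {s. Re s = 1/2}"
    unfolding julia_line_def
  proof (intro conjI allI impI complex_line_critical picard_property_onI takes_value)
    fix S R assume "open_strip S \<and> {s. Re s = 1/2} \<subseteq> S"
    then obtain \<delta> where \<delta>: "\<delta> > 0" "{s. \<bar>Re s - 1/2\<bar> < \<delta>} \<subseteq> S"
      using open_strip_around_critical_line by metis
    have "\<forall>\<^sub>F x in at_top. R / ln x < \<delta>" using \<delta>(1) by real_asymp
    then have "\<forall>\<^sub>F k in sequentially. R / ln (\<tau> k) < \<delta>"
      using assms(4) by (rule eventually_compose_filterlim)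
    then have "\<forall>\<^sub>F k in sequentially. half_strip \<inter> ball (Complex (1/2) (\<tau> k)) (R / ln (\<tau> k)) \<subseteq> half_strip \<inter> S"
    proof eventually_elim
      case (elim k)
      have "\<bar>Re z - 1/2\<bar> < \<delta>" if "z \<in> ball (Complex (1/2) (\<tau> k)) (R / ln (\<tau> k))" for z
        using that elim abs_Re_le_cmod[of "z - Complex (1/2) (\<tau> k)"]
        by (auto simp: dist_norm norm_minus_commute)
      then show ?case using \<delta>(2) by blast
    qed
    then show "\<exists>\<^sub>F k in sequentially. half_strip \<inter> ball (Complex (1/2) (\<tau> k)) (R / ln (\<tau> k)) \<subseteq> half_strip \<inter> S"
      by (rule eventually_frequently[rotated]) simp
  qed
qed

end
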